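(* Let $n\ge 1$ and $k\ge 1$ be integers. The number $w_{\le k}(n,0)$ of binary strings of length $n$ that contain no run of ones of length between $1$ and $k$ (inclusive) is $$w_{\le k}(n,0)=1+\sum_{t=1}^{\lfloor (n+1)/k\rfloor}\frac{n+1-kt}{2t}\binom{n-kt}{n+1-(k+2)t}.$$
   Context: A run of ones is a maximal block of consecutive ones, flanked on each side by a zero or by the start/end of the string. Binomial coefficients: $\binom{a}{b}$ is the usual one for integers $a\ge b\ge 0$, and $\binom{a}{b}=0$ if $b<0$ or $a<b$. *)

theory Defs
  imports Complex_Main
begin

(* A binary string is a bool list, True standing for the symbol 1.
   is_one_run xs i l: the l >= 1 consecutive positions i, ..., i + l - 1 of xs form a
   maximal block of ones. *)
definition is_one_run :: "bool list \<Rightarrow> nat \<Rightarrow> nat \<Rightarrow> bool" where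
  "is_one_run xs i l \<longleftrightarrow>
     1 \<le> l \<and> i + l \<le> length xs \<and>
     (\<forall>j. i \<le> j \<and> j < i + l \<longrightarrow> xs ! j) \<and>
     (i = 0 \<or> \<not> xs ! (i - 1)) \<and>
     (i + l = length xs \<or> \<not> xs ! (i + l))"

(* w_le_zero k n is the number written w_{\<le>k}(n,0). *)
definition w_le_zero :: "nat \<Rightarrow> nat \<Rightarrow> nat" where
  "w_le_zero k n =
     card {xs :: bool list. length xs = n \<and>
             \<not> (\<exists>i l. is_one_run xs i l \<and> 1 \<le> l \<and> l \<le> k)}"

(* Binomial coefficients with integer arguments, zero outside 0 <= b <= a.  The library's
   gchoose does not apply: it takes a natural lower index. *)
definition int_binom :: "int \<Rightarrow> int \<Rightarrow> nat" where
  "int_binom a b = (if 0 \<le> b \<and> b \<le> a then nat a choose nat b else 0)"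

end

theory Submission
  imports Defs
begin

text \<open>
  Encode a string of length \<open>n\<close> with \<open>t\<close> runs of ones by the \<open>2 t\<close> positions, among the
  \<open>n + 1\<close> gaps before, between and after its letters, at which a run starts or ends.  All runs
  are longer than \<open>k\<close> precisely when each end lies more than \<open>k\<close> gaps after its start; deleting
  \<open>k\<close> gaps from inside every run makes the choice free, so there are
  \<open>(n + 1 - k * t) choose (2 * t)\<close> such strings.  The summand of the theorem is this number,
  rewritten by \<open>N * ((N - 1) choose (m - 1)) = m * (N choose m)\<close>.

  The encoding is carried out one letter at a time.  The predicate \<open>long_runs\<close> reads a string
  from left to right and remembers the length \<open>c\<close> of the run in progress, so that the number of
  accepted strings satisfies a recursion in \<open>n\<close> (\<open>card_long_runs_Suc\<close>).  The boundary count
  extends to every \<open>c\<close>: while a run is in progress an odd number of boundaries, its end and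
  those of \<open>t\<close> further runs, is still to come.  In this form the recursion is Pascal's rule
  (\<open>card_long_runs\<close>).
\<close>

section \<open>Reading runs from left to right\<close>

fun long_runs :: "nat \<Rightarrow> nat \<Rightarrow> bool list \<Rightarrow> bool" where
  "long_runs k c [] \<longleftrightarrow> c = 0 \<or> k < c"
| "long_runs k c (True # xs) \<longleftrightarrow> long_runs k (Suc c) xs"
| "long_runs k c (False # xs) \<longleftrightarrow> (c = 0 \<or> k < c) \<and> long_runs k 0 xs"

lemma is_one_run_length_pos: "is_one_run xs i l \<Longrightarrow> 1 \<le> l"
  by (simp add: is_one_run_def)

lemma is_one_run_replicate:
  "is_one_run (replicate c True) i l \<longleftrightarrow> 1 \<le> c \<and> i = 0 \<and> l = c"
  by (auto simp: is_one_run_def)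

lemma is_one_run_replicate_False:
  "is_one_run (replicate c True @ False # ys) i l \<longleftrightarrow>
     (1 \<le> c \<and> i = 0 \<and> l = c) \<or> (Suc c \<le> i \<and> is_one_run ys (i - Suc c) l)"
  (is "?L \<longleftrightarrow> ?R")
proof (cases "Suc c \<le> i")
  case True
  define d where "d = i - Suc c"
  have i: "i = Suc c + d" using True by (simp add: d_def)
  let ?xs = "replicate c True @ False # ys"
  have nth: "?xs ! (Suc c + j) = ys ! j" for j
    by (simp add: nth_append)
  have inner: "(\<forall>j. i \<le> j \<and> j < i + l \<longrightarrow> ?xs ! j) \<longleftrightarrow> (\<forall>j. d \<le> j \<and> j < d + l \<longrightarrow> ys ! j)"
  proof
    assume L: "\<forall>j. i \<le> j \<and> j < i + l \<longrightarrow> ?xs ! j"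
    show "\<forall>j. d \<le> j \<and> j < d + l \<longrightarrow> ys ! j"
    proof (intro allI impI)
      fix j assume "d \<le> j \<and> j < d + l"
      then show "ys ! j" using L[rule_format, of "Suc c + j"] by (simp only: nth) (simp add: i)
    qed
  next
    assume R: "\<forall>j. d \<le> j \<and> j < d + l \<longrightarrow> ys ! j"
    show "\<forall>j. i \<le> j \<and> j < i + l \<longrightarrow> ?xs ! j"
    proof (intro allI impI)
      fix j assume j: "i \<le> j \<and> j < i + l"
      then obtain e where "j = Suc c + e" using i by (metis add.assoc le_Suc_ex)
      then show "?xs ! j" using R[rule_format, of e] j i by (simp only: nth) simp
    qed
  qed
  have left: "(i = 0 \<or> \<not> ?xs ! (i - 1)) \<longleftrightarrow> (d = 0 \<or> \<not> ys ! (d - 1))"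
    by (cases d) (simp_all add: i nth_append)
  have right: "?xs ! (i + l) = ys ! (d + l)"
    using nth[of "d + l"] by (simp add: i add.assoc)
  show ?thesis
    unfolding is_one_run_def inner left right d_def[symmetric] using i by auto
next
  case False
  show ?thesis
  proof
    assume ?L
    then have l: "1 \<le> l"
      and ones: "\<And>j. i \<le> j \<Longrightarrow> j < i + l \<Longrightarrow> (replicate c True @ False # ys) ! j"
      and left: "i = 0 \<or> \<not> (replicate c True @ False # ys) ! (i - 1)"
      and right: "i + l = c + Suc (length ys) \<or> \<not> (replicate c True @ False # ys) ! (i + l)"
      by (auto simp: is_one_run_def)
    have "i = 0" using left False by (auto simp: nth_append split: if_splits)
    moreover have "l \<le> c" using ones[of c] False l \<open>i = 0\<close> by (force simp: nth_append)
    moreover have "\<not> l < c" using right \<open>i = 0\<close> by (auto simp: nth_append)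
    ultimately show ?R using l by auto
  next
    assume ?R
    then show ?L using False by (auto simp: is_one_run_def nth_append)
  qed
qed

text \<open>
  The counter stands for a prefix of \<open>c\<close> ones already read: reading a one lengthens the prefix,
  and reading a zero closes its run and leaves the later runs unaffected.
\<close>

lemma long_runs_iff:
  "long_runs k c xs \<longleftrightarrow> (\<forall>i l. is_one_run (replicate c True @ xs) i l \<longrightarrow> k < l)"
proof (induction k c xs rule: long_runs.induct)
  case (1 k c)
  show ?case by (auto simp: is_one_run_replicate)
next
  case (2 k c xs)
  have "replicate (Suc c) True @ xs = replicate c True @ True # xs"
    by (simp add: replicate_app_Cons_same)
  then show ?case using 2 by simp
next
  case (3 k c xs)
  have "(\<forall>i l. is_one_run (replicate c True @ False # xs) i l \<longrightarrow> k < l) \<longleftrightarrow>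
        (c = 0 \<or> k < c) \<and> (\<forall>i l. is_one_run xs i l \<longrightarrow> k < l)"
    (is "?L \<longleftrightarrow> ?R")
  proof
    assume ?L
    then have L: "(1 \<le> c \<and> i = 0 \<and> l = c) \<or> (Suc c \<le> i \<and> is_one_run xs (i - Suc c) l) \<Longrightarrow> k < l"
      for i l
      unfolding is_one_run_replicate_False by blast
    show ?R
      using L[of 0 c] L[of "Suc c + i" l for i l] by (cases "c = 0") auto
  next
    assume ?R
    then show ?L unfolding is_one_run_replicate_False by auto
  qed
  then show ?case using 3 by simp
qed

lemma w_le_zero_eq: "w_le_zero k n = card {xs. length xs = n \<and> long_runs k 0 xs}"
proof -
  have "\<not> (\<exists>i l. is_one_run xs i l \<and> 1 \<le> l \<and> l \<le> k) \<longleftrightarrow> long_runs k 0 xs" for xs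
    using is_one_run_length_pos[of xs] unfolding long_runs_iff by (simp add: not_le) blast
  then show ?thesis by (simp add: w_le_zero_def)
qed

section \<open>Counting accepted strings\<close>

lemma card_long_runs_Suc:
  "card {xs. length xs = Suc n \<and> long_runs k c xs} =
     card {xs. length xs = n \<and> long_runs k (Suc c) xs} +
     (if c = 0 \<or> k < c then card {xs. length xs = n \<and> long_runs k 0 xs} else 0)"
proof -
  let ?S = "\<lambda>n c. {xs. length xs = n \<and> long_runs k c xs}"
  let ?Z = "if c = 0 \<or> k < c then ?S n 0 else {}"
  have fin: "finite (?S n c)" for n c
    by (rule finite_subset[OF _ finite_lists_length_eq[of "UNIV :: bool set" n]]) auto
  have "?S (Suc n) c = (#) True ` ?S n (Suc c) \<union> (#) False ` ?Z"
  proof (intro set_eqI iffI)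
    fix xs assume "xs \<in> ?S (Suc n) c"
    then show "xs \<in> (#) True ` ?S n (Suc c) \<union> (#) False ` ?Z"
      by (cases xs rule: list.exhaust; cases "hd xs") auto
  qed (auto split: if_splits)
  moreover have "card ((#) True ` ?S n (Suc c) \<union> (#) False ` ?Z) = card (?S n (Suc c)) + card ?Z"
    using fin by (subst card_Un_disjoint) (auto simp: card_image)
  ultimately show ?thesis by simp
qed

text \<open>
  Boundaries can be placed in the \<open>n + 1\<close> gaps of the unread part.  With a run of length
  \<open>c \<ge> 1\<close> in progress, its end is excluded from the first \<open>k + 1 - c\<close> of them, and each of the
  \<open>t\<close> later runs costs \<open>k\<close> more, which leaves \<open>n + c - k * (t + 1)\<close> gaps; beyond length
  \<open>k + 1\<close> the run in progress is unconstrained, whence the minimum.  Every summand with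
  \<open>t > n\<close> vanishes; the free bound \<open>T\<close> lets all sums in the induction have the same range.
\<close>

lemma card_long_runs:
  assumes "n \<le> T"
  shows "card {xs. length xs = n \<and> long_runs k c xs} =
    (if c = 0 then \<Sum>t\<le>T. (n + 1 - k * t) choose (2 * t)
     else \<Sum>t\<le>T. (n + min c (k + 1) - k * (t + 1)) choose (2 * t + 1))"
  using assms
proof (induction n arbitrary: c)
  case 0
  have nil: "{xs. xs = [] \<and> long_runs k c xs} = (if c = 0 \<or> k < c then {[]} else {})" for c
    by auto
  have small: "1 - k * Suc t < 2 * Suc t" for t
    by (rule le_less_trans[OF diff_le_self]) simp
  have even_sum: "(\<Sum>t\<le>T. (1 - k * t) choose (2 * t)) = 1"
    using small by (subst sum.atMost_shift) (simp add: binomial_eq_0)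
  have odd_sum: "(\<Sum>t\<le>T. (1 - k * t) choose (2 * t + 1)) = 1"
    by (subst sum.atMost_shift) (simp add: binomial_eq_0)
  consider "c = 0" | "1 \<le> c" "c \<le> k" | "k < c" by linarith
  then show ?case
  proof cases
    case 1
    then show ?thesis using even_sum by (simp add: nil)
  next
    case 2
    then show ?thesis by (simp add: nil)
  next
    case 3
    then have "0 + min c (k + 1) - k * (t + 1) = 1 - k * t" for t
      by (simp add: min_absorb2)
    then show ?thesis using 3 odd_sum by (simp add: nil)
  qed
next
  case (Suc n)
  note IH = Suc.IH[OF Suc_leD[OF Suc.prems]]
  consider "c = 0" | "1 \<le> c" "c \<le> k" | "k < c" by linarith
  then show ?case
  proof cases
    case 1
    have pascal: "(n + 2 - k * (t + 1)) choose (2 * (t + 1)) =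
        ((n + 1 - k * (t + 1)) choose (2 * (t + 1))) + ((n + 1 - k * (t + 1)) choose (2 * t + 1))" for t
    proof (cases "k * (t + 1) \<le> n + 1")
      case True
      then have "n + 2 - k * (t + 1) = Suc (n + 1 - k * (t + 1))" by linarith
      then show ?thesis by simp
    next
      case False
      then show ?thesis by (simp add: binomial_eq_0)
    qed
    \<comment> \<open>A run starting at the next gap uses up one of the \<open>2 * (t + 1)\<close> boundaries, so Pascal's rule
      gives the odd sum only up to \<open>T - 1\<close>; its summand at \<open>T\<close> is zero.\<close>
    have last: "(n + 1 - k * (T + 1)) choose (2 * T + 1) = 0"
      using Suc.prems by (intro binomial_eq_0) linarith
    have "(\<Sum>t\<le>T. (n + 2 - k * t) choose (2 * t)) =
        1 + (\<Sum>t<T. (n + 2 - k * (t + 1)) choose (2 * (t + 1)))"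
      by (subst sum.atMost_shift) simp
    also have "\<dots> = (1 + (\<Sum>t<T. (n + 1 - k * (t + 1)) choose (2 * (t + 1))))
        + (\<Sum>t<T. (n + 1 - k * (t + 1)) choose (2 * t + 1))"
      by (simp only: pascal sum.distrib add.assoc)
    also have "1 + (\<Sum>t<T. (n + 1 - k * (t + 1)) choose (2 * (t + 1))) =
        (\<Sum>t\<le>T. (n + 1 - k * t) choose (2 * t))"
      by (subst sum.atMost_shift) simp
    also have "(\<Sum>t<T. (n + 1 - k * (t + 1)) choose (2 * t + 1)) =
        (\<Sum>t\<le>T. (n + 1 - k * (t + 1)) choose (2 * t + 1))"
      using last by (simp only: lessThan_Suc_atMost[symmetric] sum.lessThan_Suc)
    finally show ?thesis
      using 1 by (simp add: card_long_runs_Suc IH)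
  next
    case 2
    then show ?thesis by (simp add: card_long_runs_Suc IH)
  next
    case 3
    have pascal: "(n + 2 - k * t) choose (2 * t + 1) =
        ((n + 1 - k * t) choose (2 * t + 1)) + ((n + 1 - k * t) choose (2 * t))" for t
    proof (cases "k * t \<le> n + 1")
      case True
      then have "n + 2 - k * t = Suc (n + 1 - k * t)" by linarith
      then show ?thesis by simp
    next
      case False
      then have "t \<noteq> 0" by (intro notI) simp
      with False show ?thesis by (simp add: binomial_eq_0)
    qed
    have gaps: "m + min c' (k + 1) - k * (t + 1) = m + 1 - k * t" if "k < c'" for m c' t
      using that by (simp add: min_absorb2)
    show ?thesis
      using 3 gaps[of "Suc c" n] gaps[of c "Suc n"] pascal
      by (simp add: card_long_runs_Suc IH sum.distrib)
  qed
qed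

section \<open>The closed formula\<close>

text \<open>
  The lower index \<open>n + 1 - (k + 2) * t\<close> is the complement of \<open>2 * t - 1\<close> in \<open>n - k * t\<close>, so
  the symmetry of binomial coefficients brings the summand into the form to which absorption
  applies.
\<close>

lemma int_binom_absorb:
  assumes "1 \<le> t" and "k * t \<le> n + 1"
  shows "((real n + 1 - real k * real t) / (2 * real t)) *
      real (int_binom (int n - int k * int t) (int n + 1 - (int k + 2) * int t)) =
    real ((n + 1 - k * t) choose (2 * t))"
proof (cases "2 * t \<le> n + 1 - k * t")
  case False
  then have "int n + 1 - (int k + 2) * int t < 0"
    using assms(2) by (simp add: algebra_simps flip: of_nat_mult)
  with False show ?thesis by (simp add: int_binom_def)
next
  case True
  define M where "M = n - k * t"
  have N: "n + 1 - k * t = Suc M" and n: "n = M + k * t"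
    using True assms by (auto simp: M_def)
  have top: "int n - int k * int t = int M" using n by simp
  have bot: "int n + 1 - (int k + 2) * int t = int (M - (2 * t - 1))"
    using n True N assms(1) by (simp add: algebra_simps of_nat_diff)
  have "int_binom (int M) (int (M - (2 * t - 1))) = M choose (M - (2 * t - 1))"
    by (simp add: int_binom_def)
  also have "\<dots> = M choose (2 * t - 1)"
    using True N by (intro binomial_symmetric[symmetric]) simp
  finally have bin: "int_binom (int M) (int (M - (2 * t - 1))) = M choose (2 * t - 1)" .
  have "Suc (2 * t - 1) * (Suc M choose Suc (2 * t - 1)) = Suc M * (M choose (2 * t - 1))"
    by (rule Suc_times_binomial)
  then have "2 * t * (Suc M choose (2 * t)) = Suc M * (M choose (2 * t - 1))"
    using assms(1) by simp
  then have "2 * real t * real (Suc M choose (2 * t)) = real (Suc M) * real (M choose (2 * t - 1))"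
    by (metis of_nat_mult of_nat_numeral)
  moreover have "real n + 1 - real k * real t = real (Suc M)" using n by simp
  ultimately show ?thesis
    unfolding top bot bin N using assms(1) by (simp add: field_simps)
qed

theorem mainTheorem7:
  fixes n k :: nat
  assumes "n \<ge> 1" and "k \<ge> 1"
  shows "real (w_le_zero k n) =
    1 + (\<Sum>t = 1..(n + 1) div k.
           ((real n + 1 - real k * real t) / (2 * real t)) *
           real (int_binom (int n - int k * int t) (int n + 1 - (int k + 2) * int t)))"
proof -
  let ?f = "\<lambda>t. (n + 1 - k * t) choose (2 * t)"
  have "w_le_zero k n = (\<Sum>t\<le>n + 1. ?f t)"
    by (simp add: w_le_zero_eq card_long_runs[where T = "n + 1"])
  also have "\<dots> = ?f 0 + (\<Sum>t = 1..n + 1. ?f t)"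
    by (simp add: atMost_atLeast0 sum.atLeast_Suc_atMost)
  also have "(\<Sum>t = 1..n + 1. ?f t) = (\<Sum>t = 1..(n + 1) div k. ?f t)"
  proof (rule sum.mono_neutral_right)
    show "{1..(n + 1) div k} \<subseteq> {1..n + 1}"
      using div_le_dividend[of "n + 1" k] by auto
    show "\<forall>t\<in>{1..n + 1} - {1..(n + 1) div k}. ?f t = 0"
    proof
      fix t assume t: "t \<in> {1..n + 1} - {1..(n + 1) div k}"
      then have "(n + 1) div k < t" by auto
      then have "n + 1 < t * k" using assms(2) by (simp add: div_less_iff_less_mult)
      then show "?f t = 0" using t by (simp add: mult.commute)
    qed
  qed simp
  finally have "real (w_le_zero k n) = 1 + (\<Sum>t = 1..(n + 1) div k. real (?f t))"
    by simp
  also have "(\<Sum>t = 1..(n + 1) div k. real (?f t)) = (\<Sum>t = 1..(n + 1) div k.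
      ((real n + 1 - real k * real t) / (2 * real t)) *
      real (int_binom (int n - int k * int t) (int n + 1 - (int k + 2) * int t)))"
  proof (rule sum.cong[OF refl])
    fix t assume t: "t \<in> {1..(n + 1) div k}"
    then have "k * t \<le> n + 1"
      using assms(2) by (simp add: less_eq_div_iff_mult_less_eq mult.commute)
    then show "real (?f t) = ((real n + 1 - real k * real t) / (2 * real t)) *
      real (int_binom (int n - int k * int t) (int n + 1 - (int k + 2) * int t))"
      using t by (intro int_binom_absorb[symmetric]) auto
  qed
  finally show ?thesis .
qed

end
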